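(* Let $[\nu,\mu)$ be a good interval. Then for every $\underline a\in(\mathbb N_{>0})^{\mathbb Z}$ with $\lambda_0(\underline a)=m(\underline a)\in(M\setminus L)\cap[\nu,\mu)$, there is $\varepsilon>0$ such that $\underline a$ satisfies the right or the left $\varepsilon$-property.
   Context: For $\underline a=(a_i)_{i\in\mathbb Z}\in(\mathbb N_{>0})^{\mathbb Z}$ and $j\in\mathbb Z$ let $\lambda_j(\underline a)=[a_j;a_{j+1},a_{j+2},\ldots]+[0;a_{j-1},a_{j-2},\ldots]$, $\ell(\underline a)=\limsup_{j\to\infty}\lambda_j(\underline a)$ and $m(\underline a)=\sup_{j\in\mathbb Z}\lambda_j(\underline a)$. The Lagrange spectrum $L\subset\mathbb R$ is the set of finite values $\ell(\underline a)$ and the Markov spectrum $M\subset\mathbb R$ is the set of finite values $m(\underline a)$. $\varepsilon$-property: a bi-infinite sequence $\underline a=(a_n)_{n\in\mathbb Z}$ has the right (respectively left) $\varepsilon$-property if there is an integer $N$ such that for any $\underline a'=(a'_n)_{n\in\mathbb Z}$ different from $\underline a$ with $a_n=a'_n$ for all $n\le N$ (respectively $n\ge N$) we have $m(\underline a')>m(\underline a)+\varepsilon$. Subshifts: a subshift of finite type is the set of bi-infinite sequences over a finite alphabet $\{1,\dots,A\}$ avoiding a finite list of finite words. It is symmetric if it is invariant under transposition $(a_i)\mapsto(a_{-i})$, and transitive (in particular nonempty) if for any two finite words $u,v$ occurring in its elements there is an element in which $u$ and $v$ occur without overlap, in this order. $\Sigma^+(B)=\{(a_n)_{n\ge0}:(a_n)_{n\in\mathbb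 Z}\in\Sigma(B)\}$. Good interval: $[\nu,\mu)$ is good if it can be covered by intervals $[x,y)$, each having two symmetric transitive subshifts of finite type $\Sigma(B)\subset\Sigma(C)\subset(\mathbb N_{>0})^{\mathbb Z}$ associated with it such that: $x=\sup\{m(\underline b):\underline b\in\Sigma(B)\}$; every $\underline c\in(\mathbb N_{>0})^{\mathbb Z}$ with $m(\underline c)<y$ lies in $\Sigma(C)$; and for every $\underline a$ with $m(\underline a)=\lambda_0(\underline a)<y$ the following holds: whenever $N\in\mathbb N$ and $v^1,v^2\in\Sigma^+(C)$ are two continuations with different first terms (with $m(\ldots a_{-1}a_0\ldots a_Nv^i)<y$ for $i=1,2$), there are a (perhaps empty) finite word $\tau$ and $v_B\in\Sigma^+(B)$ such that $$m(\ldots a_{-1}a_0\ldots a_N\tau v_B)\le\max\{m(\ldots a_{-1}a_0\ldots a_Nv^1),\,m(\ldots a_{-1}a_0\ldots a_Nv^2),\,x\}.$$ *)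

theory Defs
  imports Complex_Main "HOL-Library.Extended_Real" "HOL-Library.Liminf_Limsup"
begin

text \<open>The convergents \<open>[a\<^sub>0; a\<^sub>1, \<dots>, a\<^sub>n]\<close>, computed by
  \<open>[a\<^sub>0; a\<^sub>1, \<dots>, a\<^sub>n\<^sub>+\<^sub>1] = a\<^sub>0 + 1 / [a\<^sub>1; a\<^sub>2, \<dots>, a\<^sub>n\<^sub>+\<^sub>1]\<close>.\<close>

fun cf_conv :: "(nat \<Rightarrow> nat) \<Rightarrow> nat \<Rightarrow> real" where
  "cf_conv a 0 = real (a 0)"
| "cf_conv a (Suc n) = real (a 0) + 1 / cf_conv (\<lambda>k. a (Suc k)) n"

text \<open>Only used when \<open>a k > 0\<close> for all \<open>k \<ge> 1\<close>, in which case the convergents converge.\<close>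

definition cf :: "(nat \<Rightarrow> nat) \<Rightarrow> real" where
  "cf a = lim (cf_conv a)"

definition bi_seqs :: "(int \<Rightarrow> nat) set" where
  "bi_seqs = {a. \<forall>i. a i > 0}"

definition lambda :: "int \<Rightarrow> (int \<Rightarrow> nat) \<Rightarrow> real" where
  "lambda j a = cf (\<lambda>k. a (j + int k)) + cf (\<lambda>k. if k = 0 then 0 else a (j - int k))"

text \<open>The limit superior and the supremum may be infinite, hence they are taken in \<^typ>\<open>ereal\<close>;
  the spectra consist of their finite values.\<close>

definition lagrange_value :: "(int \<Rightarrow> nat) \<Rightarrow> ereal" where
  "lagrange_value a = Limsup at_top (\<lambda>j. ereal (lambda j a))"

definition markov_value :: "(int \<Rightarrow> nat) \<Rightarrow> ereal" where
  "markov_value a = (SUP j. ereal (lambda j a))"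

definition lagrange_spectrum :: "real set" where
  "lagrange_spectrum = {r. \<exists>a\<in>bi_seqs. lagrange_value a = ereal r}"

definition markov_spectrum :: "real set" where
  "markov_spectrum = {r. \<exists>a\<in>bi_seqs. markov_value a = ereal r}"

definition right_eps_property :: "real \<Rightarrow> (int \<Rightarrow> nat) \<Rightarrow> bool" where
  "right_eps_property \<epsilon> a \<longleftrightarrow>
     (\<exists>N. \<forall>a'\<in>bi_seqs. a' \<noteq> a \<longrightarrow> (\<forall>n\<le>N. a n = a' n) \<longrightarrow>
        markov_value a' > markov_value a + ereal \<epsilon>)"

definition left_eps_property :: "real \<Rightarrow> (int \<Rightarrow> nat) \<Rightarrow> bool" where
  "left_eps_property \<epsilon> a \<longleftrightarrow>
     (\<exists>N. \<forall>a'\<in>bi_seqs. a' \<noteq> a \<longrightarrow> (\<forall>n\<ge>N. a n = a' n) \<longrightarrow>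
        markov_value a' > markov_value a + ereal \<epsilon>)"

definition occurs_at :: "nat list \<Rightarrow> (int \<Rightarrow> nat) \<Rightarrow> int \<Rightarrow> bool" where
  "occurs_at w a i \<longleftrightarrow> (\<forall>k<length w. a (i + int k) = w ! k)"

definition occurs :: "nat list \<Rightarrow> (int \<Rightarrow> nat) \<Rightarrow> bool" where
  "occurs w a \<longleftrightarrow> (\<exists>i. occurs_at w a i)"

definition subshift_finite_type :: "(int \<Rightarrow> nat) set \<Rightarrow> bool" where
  "subshift_finite_type S \<longleftrightarrow>
     (\<exists>(A::nat) (F::nat list set). finite F \<and>
        S = {a. range a \<subseteq> {1..A} \<and> (\<forall>w\<in>F. \<not> occurs w a)})"

definition transposition :: "(int \<Rightarrow> nat) \<Rightarrow> int \<Rightarrow> nat" where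
  "transposition a = (\<lambda>i. a (- i))"

definition symmetric_shift :: "(int \<Rightarrow> nat) set \<Rightarrow> bool" where
  "symmetric_shift S \<longleftrightarrow> transposition ` S = S"

definition transitive_shift :: "(int \<Rightarrow> nat) set \<Rightarrow> bool" where
  "transitive_shift S \<longleftrightarrow> S \<noteq> {} \<and>
     (\<forall>u v. (\<exists>a\<in>S. occurs u a) \<longrightarrow> (\<exists>a\<in>S. occurs v a) \<longrightarrow>
        (\<exists>a\<in>S. \<exists>i j. occurs_at u a i \<and> occurs_at v a j \<and> i + int (length u) \<le> j))"

definition one_sided :: "(int \<Rightarrow> nat) set \<Rightarrow> (nat \<Rightarrow> nat) set" where
  "one_sided S = {\<lambda>n. a (int n) | a. a \<in> S}"

text \<open>\<open>continue a N v\<close> is the sequence \<open>\<dots> a\<^sub>-\<^sub>1 a\<^sub>0 \<dots> a\<^sub>N v\<^sub>0 v\<^sub>1 \<dots>\<close>, with its indexing inherited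
  from \<open>a\<close>, and \<open>prepend \<tau> v\<close> is the one-sided sequence \<open>\<tau> v\<^sub>0 v\<^sub>1 \<dots>\<close>.\<close>

definition continue :: "(int \<Rightarrow> nat) \<Rightarrow> nat \<Rightarrow> (nat \<Rightarrow> nat) \<Rightarrow> int \<Rightarrow> nat" where
  "continue a N v = (\<lambda>n. if n \<le> int N then a n else v (nat (n - int N - 1)))"

definition prepend :: "nat list \<Rightarrow> (nat \<Rightarrow> nat) \<Rightarrow> nat \<Rightarrow> nat" where
  "prepend \<tau> v = (\<lambda>k. if k < length \<tau> then \<tau> ! k else v (k - length \<tau>))"

definition good_piece ::
  "real \<Rightarrow> real \<Rightarrow> (int \<Rightarrow> nat) set \<Rightarrow> (int \<Rightarrow> nat) set \<Rightarrow> bool" where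
  "good_piece x y \<Sigma>B \<Sigma>C \<longleftrightarrow>
     subshift_finite_type \<Sigma>B \<and> symmetric_shift \<Sigma>B \<and> transitive_shift \<Sigma>B \<and>
     subshift_finite_type \<Sigma>C \<and> symmetric_shift \<Sigma>C \<and> transitive_shift \<Sigma>C \<and>
     \<Sigma>B \<subseteq> \<Sigma>C \<and>
     ereal x = (SUP b\<in>\<Sigma>B. markov_value b) \<and>
     (\<forall>c\<in>bi_seqs. markov_value c < ereal y \<longrightarrow> c \<in> \<Sigma>C) \<and>
     (\<forall>a\<in>bi_seqs. markov_value a = ereal (lambda 0 a) \<longrightarrow> markov_value a < ereal y \<longrightarrow>
       (\<forall>N. \<forall>v1\<in>one_sided \<Sigma>C. \<forall>v2\<in>one_sided \<Sigma>C.
          v1 0 \<noteq> v2 0 \<longrightarrow>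
          markov_value (continue a N v1) < ereal y \<longrightarrow>
          markov_value (continue a N v2) < ereal y \<longrightarrow>
          (\<exists>\<tau> vB. (\<forall>t\<in>set \<tau>. t > 0) \<and> vB \<in> one_sided \<Sigma>B \<and>
             markov_value (continue a N (prepend \<tau> vB)) \<le>
               max (max (markov_value (continue a N v1)) (markov_value (continue a N v2)))
                   (ereal x))))"

definition good_interval :: "real \<Rightarrow> real \<Rightarrow> bool" where
  "good_interval \<nu> \<mu> \<longleftrightarrow>
     (\<exists>I :: (real \<times> real) set.
        {\<nu>..<\<mu>} \<subseteq> (\<Union>(x, y)\<in>I. {x..<y}) \<and>
        (\<forall>(x, y)\<in>I. \<exists>\<Sigma>B \<Sigma>C. good_piece x y \<Sigma>B \<Sigma>C))"

end

theory Submission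
  imports Defs
begin

text \<open>Suppose that \<open>a\<close> has neither property for any \<open>\<epsilon>\<close>. Then for every \<open>\<epsilon>\<close> there are sequences other
  than \<open>a\<close> of Markov value at most \<open>m(a) + \<epsilon>\<close> that agree with \<open>a\<close> up to a late index, and the goodness
  of the interval, applied to \<open>a\<close> and such a sequence after the last common index, yields a sequence
  of Markov value at most \<open>m(a) + \<epsilon>\<close> whose right tail lies in \<open>\<Sigma>\<^sup>+(B)\<close>; by transposition the same holds
  on the left. Elements of \<open>\<Sigma>(B)\<close> have Markov value at most \<open>x \<le> m(a)\<close>, so by transitivity of
  \<open>\<Sigma>(B)\<close> both kinds of tails can be joined inside \<open>\<Sigma>(B)\<close>. This gives words around
  \<open>a\<^sub>-\<^sub>n \<dots> a\<^sub>n\<close> which can be concatenated for \<open>\<epsilon> \<rightarrow> 0\<close> and \<open>n \<rightarrow> \<infinity>\<close> to a sequence of Lagrange value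
  \<open>m(a)\<close>, contradicting \<open>m(a) \<notin> L\<close>.\<close>

section \<open>Continuity of continued fractions\<close>

lemma cf_conv_ge_1:
  assumes "\<forall>k. a k > 0"
  shows "cf_conv a n \<ge> 1"
  using assms
proof (induction n arbitrary: a)
  case 0
  then show ?case by (simp add: Suc_leI)
next
  case (Suc n)
  have "cf_conv (\<lambda>k. a (Suc k)) n \<ge> 1" using Suc.prems by (intro Suc.IH) simp
  moreover have "real (a 0) \<ge> 1" using Suc.prems by (simp add: Suc_leI)
  ultimately show ?case by (simp add: add_increasing2)
qed

lemma cf_conv_bounds:
  assumes "\<forall>k\<ge>1. a k > 0"
  shows "real (a 0) \<le> cf_conv a n" "cf_conv a n \<le> real (a 0) + 1"
proof -
  have "real (a 0) \<le> cf_conv a n \<and> cf_conv a n \<le> real (a 0) + 1"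
  proof (cases n)
    case (Suc p)
    have "cf_conv (\<lambda>k. a (Suc k)) p \<ge> 1" using assms by (intro cf_conv_ge_1) simp
    then show ?thesis using Suc by (simp add: field_simps)
  qed simp
  then show "real (a 0) \<le> cf_conv a n" "cf_conv a n \<le> real (a 0) + 1" by auto
qed

text \<open>The map from \<open>w\<close> to \<open>1 / (d + 1 / w) = w / (d * w + 1)\<close> is a
  Moebius transformation of determinant 1, so it divides differences by
  \<open>(d * y + 1) * (d * z + 1)\<close>, which is at least 4. Two steps are taken together
  because one step does not contract uniformly: \<open>1 / w\<close> has slope -1 at
  \<open>w = 1\<close>.\<close>

lemma two_step_contraction:
  fixes d y z :: real
  assumes "d \<ge> 1" "y \<ge> 1" "z \<ge> 1"
  shows "\<bar>1 / (d + 1 / y) - 1 / (d + 1 / z)\<bar> \<le> \<bar>y - z\<bar> / 4"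
proof -
  have 1: "d * y + 1 \<ge> 2" "d * z + 1 \<ge> 2"
    using mult_mono[of 1 d 1 y] mult_mono[of 1 d 1 z] assms by simp_all
  have 2: "1 / (d + 1 / w) = w / (d * w + 1)" if "w \<ge> 1" for w
  proof -
    have "d + 1 / w = (d * w + 1) / w" using that by (simp add: add_divide_distrib)
    then show ?thesis by simp
  qed
  have "1 / (d + 1 / y) - 1 / (d + 1 / z) = y / (d * y + 1) - z / (d * z + 1)"
    using 2 assms by presburger
  also have "\<dots> = (y * (d * z + 1) - z * (d * y + 1)) / ((d * y + 1) * (d * z + 1))"
    using 1 by (intro diff_frac_eq) auto
  also have "y * (d * z + 1) - z * (d * y + 1) = y - z" by (simp add: algebra_simps)
  finally have "\<bar>1 / (d + 1 / y) - 1 / (d + 1 / z)\<bar> = \<bar>y - z\<bar> / ((d * y + 1) * (d * z + 1))"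
    using 1 by (simp only: abs_divide abs_mult)
  also have "\<dots> \<le> \<bar>y - z\<bar> / 4"
    using mult_mono[OF 1] 1 by (intro divide_left_mono) simp_all
  finally show ?thesis .
qed

text \<open>Each pair of common partial quotients contributes a factor 1/4 by the two-step
  contraction. Different lengths \<open>p\<close> and \<open>q\<close> are allowed so that one
  estimate gives both the Cauchy property and the continuity of \<open>cf\<close>. The head may be
  \<open>0\<close>, as in the second fraction of \<open>lambda\<close>.\<close>

lemma cf_conv_close:
  assumes "\<forall>k\<ge>1. a k > 0" "\<forall>k\<ge>1. b k > 0" "\<forall>k\<le>2*K. a k = b k"
    and "p \<ge> 2*K" "q \<ge> 2*K"
  shows "\<bar>cf_conv a p - cf_conv b q\<bar> \<le> (1/4)^K"
  using assms
proof (induction K arbitrary: a b p q)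
  case 0
  then show ?case
    using cf_conv_bounds[of a p] cf_conv_bounds[of b q] by (auto simp: abs_le_iff)
next
  case (Suc K)
  define p' q' where "p' = p - 2" and "q' = q - 2"
  have pq: "p = Suc (Suc p')" "q = Suc (Suc q')"
    using Suc.prems(4,5) by (auto simp: p'_def q'_def)
  define a2 b2 where "a2 = (\<lambda>k. a (Suc (Suc k)))" and "b2 = (\<lambda>k. b (Suc (Suc k)))"
  define y z where "y = cf_conv a2 p'" and "z = cf_conv b2 q'"
  have pos: "\<forall>k. a2 k > 0" "\<forall>k. b2 k > 0" using Suc.prems by (auto simp: a2_def b2_def)
  have yz: "\<bar>y - z\<bar> \<le> (1/4)^K"
    unfolding y_def z_def using Suc.prems pos
    by (intro Suc.IH) (auto simp: a2_def b2_def pq)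
  have y1: "y \<ge> 1" "z \<ge> 1" using pos by (auto simp: y_def z_def intro: cf_conv_ge_1)
  have ab: "a 0 = b 0" "a (Suc 0) = b (Suc 0)" using Suc.prems(3) by auto
  have "real (a (Suc 0)) \<ge> 1" using Suc.prems(1) by (simp add: Suc_leI)
  from two_step_contraction[OF this y1]
  have "\<bar>cf_conv a p - cf_conv b q\<bar> \<le> \<bar>y - z\<bar> / 4"
    by (simp add: pq ab y_def z_def a2_def b2_def)
  also have "\<dots> \<le> (1/4)^Suc K" using yz by simp
  finally show ?case .
qed

lemma quarter_power_less:
  fixes d :: real
  assumes "d > 0"
  obtains K :: nat where "(1/4)^K < d"
  using real_arch_pow_inv[of d "1/4"] assms by auto

lemma cf_conv_LIMSEQ:
  assumes "\<forall>k\<ge>1. a k > 0"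
  shows "cf_conv a \<longlonglongrightarrow> cf a"
proof -
  have "Cauchy (cf_conv a)"
  proof (rule metric_CauchyI)
    fix e :: real assume "e > 0"
    then obtain K :: nat where "(1/4)^K < e" by (rule quarter_power_less)
    then have "dist (cf_conv a m) (cf_conv a n) < e" if "m \<ge> 2*K" "n \<ge> 2*K" for m n
      using cf_conv_close[OF assms assms _ that] by (simp add: dist_real_def)
    then show "\<exists>M. \<forall>m\<ge>M. \<forall>n\<ge>M. dist (cf_conv a m) (cf_conv a n) < e"
      by blast
  qed
  then have "convergent (cf_conv a)" by (rule Cauchy_convergent)
  then show ?thesis unfolding cf_def by (simp add: convergent_LIMSEQ_iff)
qed

lemma cf_close:
  assumes "\<forall>k\<ge>1. a k > 0" "\<forall>k\<ge>1. b k > 0" "\<forall>k\<le>2*K. a k = b k"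
  shows "\<bar>cf a - cf b\<bar> \<le> (1/4)^K"
proof (rule Lim_bounded)
  show "(\<lambda>n. \<bar>cf_conv a n - cf_conv b n\<bar>) \<longlonglongrightarrow> \<bar>cf a - cf b\<bar>"
    using assms by (intro tendsto_intros cf_conv_LIMSEQ)
  show "\<forall>n\<ge>2*K. \<bar>cf_conv a n - cf_conv b n\<bar> \<le> (1/4)^K"
    using cf_conv_close[OF assms] by blast
qed

text \<open>Only the forward fraction in \<open>lambda\<close> carries the central term; splitting
  it off puts both fractions into the same form.\<close>

lemma cf_split_head:
  assumes "\<forall>k\<ge>1. a k > 0"
  shows "cf a = real (a 0) + cf (\<lambda>k. if k = 0 then 0 else a k)"
proof (rule LIMSEQ_unique)
  show "cf_conv a \<longlonglongrightarrow> cf a" using assms by (rule cf_conv_LIMSEQ)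
  have "cf_conv a n = real (a 0) + cf_conv (\<lambda>k. if k = 0 then 0 else a k) n" for n
    by (cases n) auto
  moreover have "(\<lambda>n. real (a 0) + cf_conv (\<lambda>k. if k = 0 then 0 else a k) n)
      \<longlonglongrightarrow> real (a 0) + cf (\<lambda>k. if k = 0 then 0 else a k)"
    using assms by (intro tendsto_intros cf_conv_LIMSEQ) auto
  ultimately show "cf_conv a \<longlonglongrightarrow> real (a 0) + cf (\<lambda>k. if k = 0 then 0 else a k)"
    by presburger
qed

lemma lambda_close:
  assumes "c \<in> bi_seqs" "d \<in> bi_seqs"
    and "\<And>t. \<bar>t\<bar> \<le> 2 * int K \<Longrightarrow> c (i + t) = d (j + t)"
  shows "\<bar>lambda i c - lambda j d\<bar> \<le> 2 * (1/4)^K"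
proof -
  have "\<bar>cf (\<lambda>k. c (i + int k)) - cf (\<lambda>k. d (j + int k))\<bar> \<le> (1/4)^K"
    using assms by (intro cf_close) (auto simp: bi_seqs_def)
  moreover have "\<bar>cf (\<lambda>k. if k = 0 then 0 else c (i - int k))
      - cf (\<lambda>k. if k = 0 then 0 else d (j - int k))\<bar> \<le> (1/4)^K"
    using assms(1,2) assms(3)[of "- int k" for k] by (intro cf_close) (auto simp: bi_seqs_def)
  ultimately show ?thesis by (simp add: lambda_def abs_le_iff)
qed

section \<open>Shifts and transposition\<close>

lemma lambda_shift: "lambda j (\<lambda>i. a (s + i)) = lambda (s + j) a"
  by (simp add: lambda_def algebra_simps cong: if_cong)

lemma markov_value_shift: "markov_value (\<lambda>i. a (s + i)) = markov_value a"
proof -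
  have "range (\<lambda>j. ereal (lambda (s + j) a)) = range (\<lambda>j. ereal (lambda j a))"
  proof safe
    fix j
    have "lambda j a = lambda (s + (j - s)) a" by simp
    then show "ereal (lambda j a) \<in> range (\<lambda>j. ereal (lambda (s + j) a))" by blast
  qed auto
  then show ?thesis by (simp add: markov_value_def lambda_shift)
qed

lemma transposition_transposition [simp]: "transposition (transposition a) = a"
  by (simp add: transposition_def)

lemma transposition_bi_seqs [simp]: "transposition a \<in> bi_seqs \<longleftrightarrow> a \<in> bi_seqs"
  by (auto simp: transposition_def bi_seqs_def) (metis minus_minus)

text \<open>Reversal exchanges the forward and the backward fraction; with the central term split
  off, the sum is symmetric in them.\<close>

lemma lambda_transposition:
  assumes "a \<in> bi_seqs"
  shows "lambda j (transposition a) = lambda (- j) a"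
proof -
  have "cf (\<lambda>k. c (i + int k)) = real (c i) + cf (\<lambda>k. if k = 0 then 0 else c (i + int k))"
    if "c \<in> bi_seqs" for c i
    using cf_split_head[of "\<lambda>k. c (i + int k)"] that by (simp add: bi_seqs_def)
  from this[OF assms, of "- j"] this[of "transposition a" j] show ?thesis
    using assms transposition_bi_seqs[of a]
    by (simp add: lambda_def transposition_def algebra_simps del: transposition_bi_seqs cong: if_cong)
qed

lemma markov_value_transposition:
  assumes "a \<in> bi_seqs"
  shows "markov_value (transposition a) = markov_value a"
proof -
  have "range (\<lambda>j. ereal (lambda (- j) a)) = range (\<lambda>j. ereal (lambda j a))"
  proof safe
    fix j
    have "lambda j a = lambda (- (- j)) a" by simp
    then show "ereal (lambda j a) \<in> range (\<lambda>j. ereal (lambda (- j) a))" by blast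
  qed auto
  then show ?thesis by (simp add: markov_value_def lambda_transposition[OF assms])
qed

lemma right_eps_property_transposition:
  assumes "right_eps_property \<epsilon> (transposition a)" "a \<in> bi_seqs"
  shows "left_eps_property \<epsilon> a"
proof -
  obtain N where N: "\<And>a'. a' \<in> bi_seqs \<Longrightarrow> a' \<noteq> transposition a \<Longrightarrow>
      (\<forall>n\<le>N. transposition a n = a' n) \<Longrightarrow>
      markov_value a' > markov_value (transposition a) + ereal \<epsilon>"
    using assms(1) unfolding right_eps_property_def by blast
  show ?thesis unfolding left_eps_property_def
  proof (intro exI[of _ "- N"] ballI impI)
    fix a' assume a': "a' \<in> bi_seqs" "a' \<noteq> a" "\<forall>n\<ge>-N. a n = a' n"
    have "transposition a' \<noteq> transposition a"
      using a'(2) by (metis transposition_transposition)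
    moreover have "\<forall>n\<le>N. transposition a n = transposition a' n"
      using a'(3) by (simp add: transposition_def)
    ultimately show "markov_value a' > markov_value a + ereal \<epsilon>"
      using N[of "transposition a'"] a'(1) assms(2) by (simp add: markov_value_transposition)
  qed
qed

section \<open>Admissible words\<close>

definition seg :: "(int \<Rightarrow> nat) \<Rightarrow> int \<Rightarrow> nat \<Rightarrow> nat list" where
  "seg c i l = map (\<lambda>k. c (i + int k)) [0..<l]"

lemma length_seg [simp]: "length (seg c i l) = l"
  by (simp add: seg_def)

lemma nth_seg [simp]: "k < l \<Longrightarrow> seg c i l ! k = c (i + int k)"
  by (simp add: seg_def)

lemma occurs_seg [simp]: "occurs (seg c i l) c"
  by (auto simp: occurs_def occurs_at_def)

lemma seg_append: "seg c i l @ seg c (i + int l) k = seg c i (l + k)"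
  by (auto simp: list_eq_iff_nth_eq nth_append algebra_simps of_nat_diff)

lemma occurs_at_iff_seg: "occurs_at w c i \<longleftrightarrow> w = seg c i (length w)"
  by (auto simp: occurs_at_def list_eq_iff_nth_eq)

lemma occurs_factor:
  assumes "occurs (p @ w @ q) c"
  shows "occurs w c"
proof -
  obtain i where i: "\<forall>k<length (p @ w @ q). c (i + int k) = (p @ w @ q) ! k"
    using assms by (auto simp: occurs_def occurs_at_def)
  have "c (i + int (length p) + int k) = w ! k" if "k < length w" for k
    using i[rule_format, of "length p + k"] that by (simp add: nth_append add.assoc)
  then show ?thesis unfolding occurs_def occurs_at_def by blast
qed

text \<open>Bounding the length of the factors from above rather than fixing it makes \<open>admissible\<close>
  antitone in \<open>n\<close> also for words shorter than \<open>n\<close>.\<close>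

definition admissible :: "nat \<Rightarrow> (int \<Rightarrow> nat) set \<Rightarrow> nat list \<Rightarrow> bool" where
  "admissible n S P \<longleftrightarrow> (\<forall>p w q. P = p @ w @ q \<longrightarrow> length w \<le> n \<longrightarrow> (\<exists>c\<in>S. occurs w c))"

lemma admissibleD: "admissible n S (p @ w @ q) \<Longrightarrow> length w \<le> n \<Longrightarrow> \<exists>c\<in>S. occurs w c"
  by (erule admissible_def[THEN iffD1, rule_format, OF _ refl])

lemma admissible_mono:
  assumes "admissible n S P" "m \<le> n" "S \<subseteq> T"
  shows "admissible m T P"
  unfolding admissible_def
proof (intro allI impI)
  fix p w q assume w: "P = p @ w @ q" "length w \<le> m"
  have "\<exists>c\<in>S. occurs w c"
    using admissibleD[of n S p w q] assms(1,2) w by simp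
  then show "\<exists>c\<in>T. occurs w c" using assms(3) by blast
qed

lemma occurs_imp_admissible:
  assumes "occurs P c" "c \<in> S"
  shows "admissible n S P"
  unfolding admissible_def using assms occurs_factor[of _ _ _ c] by metis

text \<open>A factor of length at most \<open>n\<close> that starts inside \<open>u\<close> ends
  before \<open>v\<close> begins, because \<open>s\<close> is at least as long. So every such factor
  lies in \<open>u @ s\<close> or in \<open>s @ v\<close>.\<close>

lemma admissible_glue:
  assumes us: "admissible n S (u @ s)" and sv: "admissible n S (s @ v)" and "n \<le> length s"
  shows "admissible n S (u @ s @ v)"
  unfolding admissible_def
proof (intro allI impI)
  fix p w q assume eq: "u @ s @ v = p @ w @ q" and w: "length w \<le> n"
  show "\<exists>c\<in>S. occurs w c"
  proof (cases "length u \<le> length p")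
    case True
    have "s @ v = drop (length u) (p @ w @ q)" by (simp flip: eq)
    then have "s @ v = drop (length u) p @ w @ q" using True by simp
    then show ?thesis using sv w unfolding admissible_def by blast
  next
    case False
    have "u @ s = take (length (u @ s)) (p @ w @ q)" by (simp flip: eq)
    also have "\<dots> = p @ w @ take (length (u @ s) - length (p @ w)) q"
      using False w assms(3) by simp
    finally have "u @ s = p @ w @ take (length (u @ s) - length (p @ w)) q" .
    then show ?thesis using us w unfolding admissible_def by blast
  qed
qed

text \<open>The connecting word \<open>g\<close> is what stands between the two non-overlapping
  occurrences; it may be empty.\<close>

lemma transitive_connect:
  assumes "transitive_shift S" "u' \<in> S" "occurs u u'" "v' \<in> S" "occurs v v'"
  obtains g c where "c \<in> S" "occurs (u @ g @ v) c"
proof -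
  obtain c i j where c: "c \<in> S" "occurs_at u c i" "occurs_at v c j" "i + int (length u) \<le> j"
    using assms unfolding transitive_shift_def by meson
  define l where "l = nat (j - (i + int (length u)))"
  have j: "j = i + int (length u) + int l" using c(4) by (simp add: l_def)
  have "u @ seg c (i + int (length u)) l @ v = seg c i (length u + (l + length v))"
    using c(2,3) by (metis occurs_at_iff_seg j seg_append)
  then show thesis using that c(1) occurs_seg by metis
qed

lemma subshift_finite_type_bi_seqs:
  assumes "subshift_finite_type S"
  shows "S \<subseteq> bi_seqs"
proof
  fix a assume "a \<in> S"
  then obtain A :: nat where "range a \<subseteq> {1..A}"
    using assms by (auto simp: subshift_finite_type_def)
  then have "a i \<in> {1..A}" for i by blast
  then show "a \<in> bi_seqs" by (auto simp: bi_seqs_def Suc_le_eq)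
qed

section \<open>Sequences almost realising the Markov value\<close>

text \<open>The failing property, taken at index \<open>n\<close>, provides a competitor
  \<open>a'\<close>. The tails of \<open>a\<close> and \<open>a'\<close> after their last common
  index are two continuations with different first terms, and goodness replaces them by a tail from
  \<open>B\<close>.\<close>

lemma right_extension:
  assumes piece: "good_piece x y B C"
    and a: "a \<in> bi_seqs" "markov_value a = ereal (lambda 0 a)"
    and bounds: "x \<le> lambda 0 a" "lambda 0 a + \<epsilon> < y" "\<epsilon> > 0"
    and no: "\<not> right_eps_property \<epsilon> a"
  obtains A b N p where "n \<le> N" "A \<in> bi_seqs" "markov_value A \<le> ereal (lambda 0 a + \<epsilon>)"
    "\<And>i. i \<le> int N \<Longrightarrow> A i = a i" "b \<in> B" "p > int N" "\<And>i. i \<ge> 0 \<Longrightarrow> A (p + i) = b i"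
proof -
  obtain a' where a': "a' \<in> bi_seqs" "a' \<noteq> a" "\<forall>i\<le>int n. a i = a' i"
      "markov_value a' \<le> ereal (lambda 0 a + \<epsilon>)"
    using no a(2) unfolding right_eps_property_def by (auto simp: not_less)
  \<comment> \<open>Good pieces speak only of continuations after a natural index; agreement up to
    \<open>int n\<close> excludes a difference at a negative index.\<close>
  have "\<exists>d. a (int d) \<noteq> a' (int d)"
  proof -
    obtain i where "a i \<noteq> a' i" using a'(2) by fastforce
    moreover from this have "\<not> i \<le> int n" using a'(3) by blast
    then have "i = int (nat i)" by simp
    ultimately show ?thesis by metis
  qed
  then obtain d where d: "a (int d) \<noteq> a' (int d)" "\<And>e. e < d \<Longrightarrow> a (int e) = a' (int e)"
    using exists_least_iff[of "\<lambda>d. a (int d) \<noteq> a' (int d)"] by blast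
  have "\<not> int d \<le> int n" using d(1) a'(3) by blast
  then have "n < d" by simp
  then obtain N where N: "d = Suc N" "n \<le> N" by (cases d) auto
  have eq: "a i = a' i" if "i \<le> int N" for i
  proof (cases "i \<ge> 0")
    case True
    then show ?thesis using d(2)[of "nat i"] that N by simp
  qed (use a'(3) in simp)
  define v1 v2 where "v1 = (\<lambda>k. a (int N + 1 + int k))" and "v2 = (\<lambda>k. a' (int N + 1 + int k))"
  have cont: "continue a N v1 = a" "continue a N v2 = a'"
    using eq by (auto simp: continue_def v1_def v2_def fun_eq_iff)
  have lt: "markov_value a < ereal y" "markov_value a' < ereal y"
    using a(2) bounds a'(4) by (auto intro: le_less_trans)
  have C: "c \<in> C" if "c \<in> bi_seqs" "markov_value c < ereal y" for c
    using piece that unfolding good_piece_def by blast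
  \<comment> \<open>Shift invariance of \<open>C\<close> is replaced by that of the Markov value:
    the shifted sequence is still below \<open>y\<close>, hence in \<open>C\<close>.\<close>
  have tail: "(\<lambda>k. c (int N + 1 + int k)) \<in> one_sided C"
    if "c \<in> bi_seqs" "markov_value c < ereal y" for c
  proof -
    have "(\<lambda>i. c (int N + 1 + i)) \<in> C"
      using that by (intro C) (auto simp: markov_value_shift bi_seqs_def)
    then show ?thesis
      unfolding one_sided_def by (intro CollectI exI[of _ "\<lambda>i. c (int N + 1 + i)"] conjI refl)
  qed
  have v: "v1 \<in> one_sided C" "v2 \<in> one_sided C"
    using tail a(1) a'(1) lt by (auto simp: v1_def v2_def)
  have v0: "v1 0 \<noteq> v2 0"
    using d(1) N by (simp add: v1_def v2_def add.commute)
  have "\<forall>N. \<forall>v1\<in>one_sided C. \<forall>v2\<in>one_sided C. v1 0 \<noteq> v2 0 \<longrightarrow>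
      markov_value (continue a N v1) < ereal y \<longrightarrow> markov_value (continue a N v2) < ereal y \<longrightarrow>
      (\<exists>\<tau> vB. (\<forall>t\<in>set \<tau>. t > 0) \<and> vB \<in> one_sided B \<and>
         markov_value (continue a N (prepend \<tau> vB)) \<le>
           max (max (markov_value (continue a N v1)) (markov_value (continue a N v2))) (ereal x))"
    using piece a lt(1) unfolding good_piece_def by blast
  from this[rule_format, OF v v0, of N, unfolded cont, OF lt]
  obtain \<tau> vB where \<tau>: "\<forall>t\<in>set \<tau>. t > 0" "vB \<in> one_sided B"
      "markov_value (continue a N (prepend \<tau> vB)) \<le>
         max (max (markov_value a) (markov_value a')) (ereal x)"
    by blast
  obtain b where b: "b \<in> B" "vB = (\<lambda>n. b (int n))" using \<tau>(2) unfolding one_sided_def by blast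
  have "b \<in> bi_seqs" using piece b(1) subshift_finite_type_bi_seqs unfolding good_piece_def by blast
  show thesis
  proof
    show "n \<le> N" by fact
    show "continue a N (prepend \<tau> vB) \<in> bi_seqs"
      using a(1) \<tau>(1) \<open>b \<in> bi_seqs\<close> by (auto simp: bi_seqs_def continue_def prepend_def b(2))
    have "max (max (markov_value a) (markov_value a')) (ereal x) \<le> ereal (lambda 0 a + \<epsilon>)"
      using a(2) a'(4) bounds by simp
    with \<tau>(3) show "markov_value (continue a N (prepend \<tau> vB)) \<le> ereal (lambda 0 a + \<epsilon>)"
      by (rule order_trans)
    show "continue a N (prepend \<tau> vB) i = a i" if "i \<le> int N" for i
      using that by (simp add: continue_def)
    show "b \<in> B" by fact
    \<comment> \<open>The tail from \<open>B\<close> starts right after \<open>\<tau>\<close>, which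
      itself starts at index \<open>N + 1\<close>.\<close>
    show "int N < int N + 1 + int (length \<tau>)" by simp
    show "continue a N (prepend \<tau> vB) (int N + 1 + int (length \<tau>) + i) = b i" if "i \<ge> 0" for i
    proof -
      have "nat (1 + int (length \<tau>) + i - 1) = length \<tau> + nat i" using that by simp
      then show ?thesis using that by (simp add: continue_def prepend_def b(2) nat_add_distrib)
    qed
  qed
qed

text \<open>Mirror image of the right extension: apply it to \<open>transposition a\<close> and
  reflect the result, using that \<open>B\<close> is symmetric.\<close>

lemma left_extension:
  assumes piece: "good_piece x y B C"
    and a: "a \<in> bi_seqs" "markov_value a = ereal (lambda 0 a)"
    and bounds: "x \<le> lambda 0 a" "lambda 0 a + \<epsilon> < y" "\<epsilon> > 0"
    and no: "\<not> left_eps_property \<epsilon> a"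
  obtains A b N p where "n \<le> N" "A \<in> bi_seqs" "markov_value A \<le> ereal (lambda 0 a + \<epsilon>)"
    "\<And>i. i \<ge> - int N \<Longrightarrow> A i = a i" "b \<in> B" "p > int N" "\<And>i. i \<le> 0 \<Longrightarrow> A (i - p) = b i"
proof -
  have l0: "lambda 0 (transposition a) = lambda 0 a" using lambda_transposition[OF a(1), of 0] by simp
  have ta: "transposition a \<in> bi_seqs"
      "markov_value (transposition a) = ereal (lambda 0 (transposition a))"
    using a by (simp_all add: markov_value_transposition l0)
  have nr: "\<not> right_eps_property \<epsilon> (transposition a)"
    using right_eps_property_transposition no a(1) by blast
  obtain A b N p where *: "n \<le> N" "A \<in> bi_seqs" "markov_value A \<le> ereal (lambda 0 a + \<epsilon>)"
    "\<And>i. i \<le> int N \<Longrightarrow> A i = transposition a i" "b \<in> B" "p > int N" "\<And>i. i \<ge> 0 \<Longrightarrow> A (p + i) = b i"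
    using right_extension[OF piece ta _ _ bounds(3) nr, unfolded l0, OF bounds(1,2)] by metis
  have "transposition b \<in> B"
    using piece *(5) unfolding good_piece_def symmetric_shift_def by blast
  moreover have "transposition A i = a i" if "i \<ge> - int N" for i
    using *(4)[of "- i"] that by (simp add: transposition_def)
  moreover have "transposition A (i - p) = transposition b i" if "i \<le> 0" for i
    using *(7)[of "- i"] that by (simp add: transposition_def)
  ultimately show thesis
    using that[of N "transposition A" "transposition b" p] * by (simp add: markov_value_transposition)
qed

text \<open>The word \<open>R @ v\<close> begins with \<open>u\<close>, so that it can be glued to a
  preceding block that is followed by \<open>u\<close>. The segment of \<open>a\<close> inside
  \<open>R\<close> will make values near \<open>lambda 0 a\<close> recur.\<close>

lemma connecting_block:
  assumes piece: "good_piece x y B C"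
    and a: "a \<in> bi_seqs" "markov_value a = ereal (lambda 0 a)"
    and bounds: "x \<le> lambda 0 a" "lambda 0 a + \<epsilon> < y" "\<epsilon> > 0"
    and no: "\<not> right_eps_property \<epsilon> a" "\<not> left_eps_property \<epsilon> a"
    and u: "u' \<in> B" "occurs u u'" and v: "v' \<in> B" "occurs v v'"
  obtains R Q r1 r2 where "R @ v = u @ Q"
    "admissible n {c \<in> bi_seqs. markov_value c \<le> ereal (lambda 0 a + \<epsilon>)} (R @ v)"
    "R = r1 @ seg a (- int n) (2 * n + 1) @ r2"
proof -
  define S where "S = {c \<in> bi_seqs. markov_value c \<le> ereal (lambda 0 a + \<epsilon>)}"
  obtain A b N p where A: "n \<le> N" "A \<in> bi_seqs" "markov_value A \<le> ereal (lambda 0 a + \<epsilon>)"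
    "\<And>i. i \<le> int N \<Longrightarrow> A i = a i" "b \<in> B" "p > int N" "\<And>i. i \<ge> 0 \<Longrightarrow> A (p + i) = b i"
    using right_extension[OF piece a bounds no(1)] by metis
  obtain A' b' N' p' where A': "n \<le> N'" "A' \<in> bi_seqs" "markov_value A' \<le> ereal (lambda 0 a + \<epsilon>)"
    "\<And>i. i \<ge> - int N' \<Longrightarrow> A' i = a i" "b' \<in> B" "p' > int N'" "\<And>i. i \<le> 0 \<Longrightarrow> A' (i - p') = b' i"
    using left_extension[OF piece a bounds no(2)] by metis
  have AS: "A \<in> S" "A' \<in> S" using A A' by (auto simp: S_def)
  have "B \<subseteq> S"
  proof
    fix c assume c: "c \<in> B"
    have "markov_value c \<le> (SUP b\<in>B. markov_value b)" using c by (rule SUP_upper)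
    also have "\<dots> = ereal x" using piece unfolding good_piece_def by simp
    also have "\<dots> \<le> ereal (lambda 0 a + \<epsilon>)" using bounds by simp
    finally show "c \<in> S"
      using c piece subshift_finite_type_bi_seqs unfolding S_def good_piece_def by blast
  qed
  have trans: "transitive_shift B" using piece unfolding good_piece_def by blast

  \<comment> \<open>The block is \<open>u g\<^sub>1 t\<^sub>1 w\<^sub>1 s w\<^sub>2 t\<^sub>2 g\<^sub>2 v\<close>: its parts \<open>u g\<^sub>1 t\<^sub>1\<close> and \<open>t\<^sub>2 g\<^sub>2 v\<close> occur in \<open>B\<close>,
    \<open>t\<^sub>1 w\<^sub>1 s\<close> in \<open>A'\<close> and \<open>s w\<^sub>2 t\<^sub>2\<close> in \<open>A\<close>, and they overlap in words of length at least \<open>n\<close>.\<close>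
  define t1 where "t1 = seg b' (1 - int n) n"
  define t2 where "t2 = seg b 0 n"
  define s where "s = seg a (- int N') (N' + N + 1)"
  \<comment> \<open>\<open>w1\<close> fills the indices of \<open>A'\<close> from
    \<open>1 - p'\<close> to \<open>- N' - 1\<close>, and \<open>w2\<close> those of
    \<open>A\<close> from \<open>N + 1\<close> to \<open>p - 1\<close>.\<close>
  define w1 where "w1 = seg A' (1 - p') (nat (p' - int N' - 1))"
  define w2 where "w2 = seg A (int N + 1) (nat (p - int N - 1))"
  \<comment> \<open>Index \<open>0\<close> of \<open>b'\<close> sits at index \<open>- p'\<close> of
    \<open>A'\<close>, so \<open>t1\<close> is the last stretch of the left tail.\<close>
  have t1: "t1 = seg A' (1 - int n - p') n"
    using A'(7)[of "1 - int n + int k" for k]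
    by (auto simp: t1_def list_eq_iff_nth_eq algebra_simps)
  have t2: "t2 = seg A p n" using A(7) by (auto simp: t2_def list_eq_iff_nth_eq)
  \<comment> \<open>Both \<open>A'\<close> and \<open>A\<close> agree with \<open>a\<close> on the
    window from \<open>- N'\<close> to \<open>N\<close>, which is what lets the block pass from one
    to the other.\<close>
  have s: "s = seg A' (- int N') (N' + N + 1)" "s = seg A (- int N') (N' + N + 1)"
    using A(4) A'(4) by (auto simp: s_def list_eq_iff_nth_eq)
  have seg_join: "seg c i l @ seg c j k = seg c i (l + k)" if "j = i + int l" for c i j l k
    using that seg_append by blast
  have "occurs (t1 @ w1 @ s) A'"
  proof -
    have "w1 @ s = seg A' (1 - p') (nat (p' - int N' - 1) + (N' + N + 1))"
      unfolding w1_def s(1) using A'(6) by (intro seg_join) simp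
    moreover have "t1 @ \<dots> = seg A' (1 - int n - p') (n + (nat (p' - int N' - 1) + (N' + N + 1)))"
      unfolding t1 by (intro seg_join) simp
    ultimately show ?thesis using occurs_seg by metis
  qed
  moreover have "occurs (s @ w2 @ t2) A"
  proof -
    have "w2 @ t2 = seg A (int N + 1) (nat (p - int N - 1) + n)"
      unfolding w2_def t2 using A(6) by (intro seg_join) simp
    moreover have "s @ \<dots> = seg A (- int N') (N' + N + 1 + (nat (p - int N - 1) + n))"
      unfolding s(2) by (intro seg_join) simp
    ultimately show ?thesis using occurs_seg by metis
  qed
  ultimately have "admissible n S ((t1 @ w1) @ s)" "admissible n S (s @ w2 @ t2)"
    using AS by (auto intro: occurs_imp_admissible)
  from admissible_glue[OF this]
  have mid: "admissible n S (t1 @ w1 @ s @ w2 @ t2)" using A(1) by (simp add: s_def)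

  have occ: "occurs t1 b'" "occurs t2 b" unfolding t1_def t2_def by simp_all
  obtain g1 c1 where "c1 \<in> B" "occurs (u @ g1 @ t1) c1"
    using transitive_connect[OF trans u A'(5) occ(1)] by blast
  then have "admissible n S ((u @ g1) @ t1)"
    using \<open>B \<subseteq> S\<close> by (auto intro: occurs_imp_admissible)
  from admissible_glue[OF this mid]
  have left: "admissible n S ((u @ g1 @ t1 @ w1 @ s @ w2) @ t2)" by (simp add: t1_def)
  obtain g2 c2 where "c2 \<in> B" "occurs (t2 @ g2 @ v) c2"
    using transitive_connect[OF trans A(5) occ(2) v] by blast
  then have "admissible n S (t2 @ g2 @ v)"
    using \<open>B \<subseteq> S\<close> by (auto intro: occurs_imp_admissible)
  from admissible_glue[OF left this]
  have full: "admissible n S ((u @ g1 @ t1 @ w1 @ s @ w2) @ t2 @ g2 @ v)" by (simp add: t2_def)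

  have core: "s = seg a (- int N') (N' - n) @ seg a (- int n) (2 * n + 1) @ seg a (int n + 1) (N - n)"
  proof -
    have "seg a (- int n) (2 * n + 1) @ seg a (int n + 1) (N - n)
        = seg a (- int n) (2 * n + 1 + (N - n))"
      by (intro seg_join) simp
    moreover have "seg a (- int N') (N' - n) @ \<dots> = seg a (- int N') (N' - n + (2 * n + 1 + (N - n)))"
      using A'(1) by (intro seg_join) (simp add: of_nat_diff)
    moreover have "N' - n + (2 * n + 1 + (N - n)) = N' + N + 1" using A(1) A'(1) by simp
    ultimately show ?thesis unfolding s_def by metis
  qed
  show thesis
  proof (rule that)
    show "(u @ g1 @ t1 @ w1 @ s @ w2 @ t2 @ g2) @ v = u @ g1 @ t1 @ w1 @ s @ w2 @ t2 @ g2 @ v"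
      by simp
    show "admissible n {c \<in> bi_seqs. markov_value c \<le> ereal (lambda 0 a + \<epsilon>)}
        ((u @ g1 @ t1 @ w1 @ s @ w2 @ t2 @ g2) @ v)"
      using full by (simp add: S_def)
    show "u @ g1 @ t1 @ w1 @ s @ w2 @ t2 @ g2
        = (u @ g1 @ t1 @ w1 @ seg a (- int N') (N' - n)) @ seg a (- int n) (2 * n + 1)
          @ (seg a (int n + 1) (N - n) @ w2 @ t2 @ g2)"
      unfolding core by simp
  qed
qed

section \<open>Concatenating the blocks\<close>

text \<open>The right half of \<xi> is the concatenation of all \<open>R k\<close>. Its late factors
  occur in sequences of Markov value at most \<open>lambda 0 a + \<epsilon> i\<close>, which bounds
  the limit superior from above; the growing copies of the centre of \<open>a\<close> bound it from
  below.\<close>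

lemma lagrange_value_of_blocks:
  fixes R s :: "nat \<Rightarrow> nat list" and S :: "nat \<Rightarrow> (int \<Rightarrow> nat) set" and \<epsilon> :: "nat \<Rightarrow> real"
  assumes overlap: "\<And>k. R k @ s (Suc k) = s k @ Q k" "\<And>k. length (s k) = k"
    and adm: "\<And>k. admissible (Suc k) (S k) (R k @ s (Suc k))"
    and S: "decseq S" "\<And>k c. c \<in> S k \<Longrightarrow> c \<in> bi_seqs"
      "\<And>k c. c \<in> S k \<Longrightarrow> markov_value c \<le> ereal (lambda 0 a + \<epsilon> k)"
    and \<epsilon>: "\<epsilon> \<longlonglongrightarrow> 0"
    and core: "\<And>k. R k = r1 k @ seg a (- int (Suc k)) (2 * Suc k + 1) @ r2 k"
    and a: "a \<in> bi_seqs"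
  shows "\<exists>\<xi>\<in>bi_seqs. lagrange_value \<xi> = ereal (lambda 0 a)"
proof -
  define Y where "Y k = concat (map R [0..<k])" for k
  define Z where "Z i m = concat (map R [i..<i + Suc m])" for i m
  have Y_split: "Y (i + Suc m) = Y i @ Z i m" for i m
    unfolding Y_def Z_def by (subst upt_add_eq_append) simp_all
  have Y_Suc: "Y (Suc k) = Y k @ R k" for k by (simp add: Y_def)
  have len_Y: "k \<le> length (Y k)" for k
  proof (induction k)
    case (Suc k)
    have "length (R k) \<ge> 1" using arg_cong[OF core[of k], of length] by simp
    then show ?case using Suc by (simp add: Y_Suc)
  qed simp
  \<comment> \<open>The appended \<open>s (i + Suc m)\<close> is also a prefix of the next block
    with its look-ahead, and its length exceeds \<open>i\<close>, so the induction step can glue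
    along it. Later blocks count for \<open>S i\<close> since \<open>S\<close> decreases.\<close>
  have Z_adm: "admissible (Suc i) (S i) (Z i m @ s (i + Suc m))" for i m
  proof (induction m)
    case 0
    then show ?case using adm[of i] by (simp add: Z_def)
  next
    case (Suc m)
    let ?k = "i + Suc m"
    have "admissible (Suc i) (S i) (s ?k @ Q ?k)"
    proof (rule admissible_mono)
      show "admissible (Suc ?k) (S ?k) (s ?k @ Q ?k)" using adm[of ?k] by (simp only: overlap(1))
      show "S ?k \<subseteq> S i" using S(1) by (rule decseqD) simp
    qed simp
    from admissible_glue[OF Suc this]
    have "admissible (Suc i) (S i) (Z i m @ s ?k @ Q ?k)" by (simp add: overlap(2))
    moreover have "Z i m @ s ?k @ Q ?k = Z i (Suc m) @ s (i + Suc (Suc m))"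
      using overlap(1)[of ?k] by (simp add: Z_def)
    ultimately show ?case by simp
  qed
  \<comment> \<open>The limsup only concerns \<open>j \<rightarrow> \<infinity>\<close>, so the left half is irrelevant.\<close>
  define \<xi> :: "int \<Rightarrow> nat" where "\<xi> i = (if i \<ge> 0 then Y (Suc (nat i)) ! nat i else 1)" for i
  have \<xi>_Y: "\<xi> (int j) = Y k ! j" if "j < length (Y k)" for j k
  proof -
    have "Y k' ! j = Y l ! j" if "j < length (Y k')" "k' \<le> l" for k' l
    proof (cases "k' = l")
      case False
      then obtain m where l: "l = k' + Suc m" using \<open>k' \<le> l\<close> less_imp_Suc_add by fastforce
      show ?thesis unfolding l Y_split using that(1) by (simp add: nth_append)
    qed simp
    note ext = this
    have "\<xi> (int j) = Y (Suc j) ! j" by (simp add: \<xi>_def)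
    moreover have "j < length (Y (Suc j))" using len_Y[of "Suc j"] by simp
    moreover have "Y k ! j = Y (Suc j) ! j"
    proof (cases "k \<le> Suc j")
      case True
      then show ?thesis using ext[OF \<open>j < length (Y k)\<close>] by blast
    next
      case False
      then show ?thesis using ext[OF \<open>j < length (Y (Suc j))\<close>, of k] by simp
    qed
    ultimately show ?thesis by simp
  qed
  have \<xi>_seg: "\<exists>c\<in>S i. occurs (seg \<xi> (int j) l) c" if "length (Y i) \<le> j" "l \<le> Suc i" for i j l
  proof -
    \<comment> \<open>A generous choice: \<open>Y (i + Suc m)\<close> has length at least
      \<open>i + Suc m\<close>, so \<open>Z i m\<close> reaches beyond index
      \<open>j + l\<close>.\<close>
    define m where "m = j + l"
    define d where "d = j - length (Y i)"
    have lenZ: "j + l \<le> length (Y i) + length (Z i m)"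
      using len_Y[of "i + Suc m", unfolded Y_split] by (simp add: m_def)
    have "seg \<xi> (int j) l = take l (drop d (Z i m))"
    proof (rule nth_equalityI)
      show "length (seg \<xi> (int j) l) = length (take l (drop d (Z i m)))"
        using lenZ that by (simp add: d_def)
      fix k assume "k < length (seg \<xi> (int j) l)"
      then show "seg \<xi> (int j) l ! k = take l (drop d (Z i m)) ! k"
        using lenZ that \<xi>_Y[of "j + k" "i + Suc m", unfolded Y_split]
        by (simp add: nth_append d_def)
    qed
    then have "Z i m = take d (Z i m) @ seg \<xi> (int j) l @ drop l (drop d (Z i m))"
      by (simp only: append_take_drop_id)
    from arg_cong[OF this, of "\<lambda>z. z @ s (i + Suc m)"] Z_adm[of i m]
    have "admissible (Suc i) (S i)
        (take d (Z i m) @ seg \<xi> (int j) l @ (drop l (drop d (Z i m)) @ s (i + Suc m)))"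
      by (simp only: append_assoc)
    then show ?thesis by (rule admissibleD) (use that(2) in simp)
  qed
  have \<xi>_bi: "\<xi> \<in> bi_seqs"
  proof -
    have "\<xi> i > 0" for i
    proof (cases "i \<ge> 0")
      case True
      then obtain c where "c \<in> S 0" "occurs (seg \<xi> i 1) c"
        using \<xi>_seg[of 0 "nat i" 1] by (auto simp: Y_def)
      then show ?thesis using S(2)[of c 0]
        by (auto simp: occurs_def occurs_at_def bi_seqs_def) (metis neq0_conv)
    qed (simp add: \<xi>_def)
    then show ?thesis by (simp add: bi_seqs_def)
  qed
  have "lagrange_value \<xi> \<le> ereal (lambda 0 a)"
  proof (rule ereal_le_epsilon2)
    fix \<delta> :: real assume \<delta>: "\<delta> > 0"
    \<comment> \<open>Half of \<delta> pays for the truncation error \<open>2 * (1/4)^K\<close>, the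
      other half for \<open>\<epsilon> i\<close>. The later bound \<open>i \<ge> 4 * K\<close> makes
      the window of length \<open>4 * K + 1\<close> short enough to occur in an element of
      \<open>S i\<close>.\<close>
    then obtain K :: nat where K: "(1/4)^K < \<delta> / 4" using quarter_power_less[of "\<delta> / 4"] by auto
    have "eventually (\<lambda>i. \<epsilon> i < \<delta> / 2) sequentially"
      using \<epsilon> \<delta> by (intro order_tendstoD) auto
    then have "eventually (\<lambda>i. \<epsilon> i < \<delta> / 2 \<and> i \<ge> 4 * K) sequentially"
      using eventually_ge_at_top eventually_conj by blast
    then obtain i where i: "\<epsilon> i < \<delta> / 2" "i \<ge> 4 * K"
      using eventually_happens' sequentially_bot by blast
    have "lambda j \<xi> \<le> lambda 0 a + \<delta>" if j: "j \<ge> int (length (Y i) + 2 * K)" for j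
    proof -
      define q where "q = nat (j - 2 * int K)"
      have q: "length (Y i) \<le> q" "int q = j - 2 * int K" using j by (auto simp: q_def)
      obtain c where c: "c \<in> S i" "occurs (seg \<xi> (int q) (4 * K + 1)) c"
        using \<xi>_seg[OF q(1), of "4 * K + 1"] i(2) by auto
      then obtain e where e: "\<And>k. k < 4 * K + 1 \<Longrightarrow> c (e + int k) = \<xi> (int q + int k)"
        by (auto simp: occurs_def occurs_at_def)
      have "\<bar>lambda j \<xi> - lambda (e + 2 * int K) c\<bar> \<le> 2 * (1/4)^K"
      proof (rule lambda_close)
        show "\<xi> \<in> bi_seqs" "c \<in> bi_seqs" using \<xi>_bi S(2) c(1) by auto
        fix t assume "\<bar>t\<bar> \<le> 2 * int K"
        then have t: "nat (2 * int K + t) < 4 * K + 1" "int (nat (2 * int K + t)) = 2 * int K + t"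
          by linarith+
        then show "\<xi> (j + t) = c (e + 2 * int K + t)"
          using e[OF t(1)] unfolding t(2) q(2) by (simp add: algebra_simps)
      qed
      moreover have "lambda (e + 2 * int K) c \<le> lambda 0 a + \<epsilon> i"
      proof -
        have "ereal (lambda (e + 2 * int K) c) \<le> markov_value c"
          unfolding markov_value_def by (intro SUP_upper) simp
        also have "\<dots> \<le> ereal (lambda 0 a + \<epsilon> i)" using S(3) c(1) by blast
        finally show ?thesis by simp
      qed
      ultimately show ?thesis using K i(1) by linarith
    qed
    then have "eventually (\<lambda>j. ereal (lambda j \<xi>) \<le> ereal (lambda 0 a) + ereal \<delta>) at_top"
      unfolding eventually_at_top_linorder by auto
    then show "lagrange_value \<xi> \<le> ereal (lambda 0 a) + ereal \<delta>"
      unfolding lagrange_value_def by (rule Limsup_bounded)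
  qed
  moreover have "\<not> lagrange_value \<xi> < ereal (lambda 0 a)"
  proof
    assume "lagrange_value \<xi> < ereal (lambda 0 a)"
    then obtain r where r: "lagrange_value \<xi> < ereal r" "ereal r < ereal (lambda 0 a)"
      using ereal_dense2 by blast
    have "eventually (\<lambda>j. ereal (lambda j \<xi>) < ereal r) at_top"
      using r(1) unfolding lagrange_value_def by (rule Limsup_lessD)
    then obtain J where J: "\<And>j. j \<ge> J \<Longrightarrow> lambda j \<xi> < r"
      unfolding eventually_at_top_linorder by auto
    obtain K :: nat where K: "(1/4)^K < (lambda 0 a - r) / 2"
      using quarter_power_less[of "(lambda 0 a - r) / 2"] r(2) by auto
    \<comment> \<open>The copy of \<open>a\<close> in \<open>R k\<close> has radius
      \<open>k + 1\<close>, enough for the truncation at \<open>K\<close>, and it lies beyond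
      \<open>J\<close> because \<open>Y k\<close> has length at least \<open>k\<close>.\<close>
    define k where "k = max (2 * K) (nat J)"
    \<comment> \<open>The index in \<xi> at which the copy of \<open>a\<close> in \<open>R k\<close>
      has its term of index \<open>0\<close>.\<close>
    define q where "q = length (Y k) + length (r1 k) + Suc k"
    have "J \<le> int q" using len_Y[of k] by (auto simp: q_def k_def)
    have "\<bar>lambda (int q) \<xi> - lambda 0 a\<bar> \<le> 2 * (1/4)^K"
    proof (rule lambda_close[OF \<xi>_bi a])
      fix t assume "\<bar>t\<bar> \<le> 2 * int K"
      then have t: "\<bar>t\<bar> \<le> int k" by (simp add: k_def)
      define e where "e = nat (int (Suc k) + t)"
      have e: "e < 2 * Suc k + 1" "int e = int (Suc k) + t" using t by (auto simp: e_def)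
      have qt: "int q + t = int (length (Y k) + length (r1 k) + e)" by (simp add: q_def e(2))
      have Yk: "Y (Suc k) = Y k @ r1 k @ seg a (- int (Suc k)) (2 * Suc k + 1) @ r2 k"
        by (metis Y_Suc core)
      have "\<xi> (int q + t) = Y (Suc k) ! (length (Y k) + length (r1 k) + e)"
        unfolding qt using e(1) by (intro \<xi>_Y) (simp add: Yk)
      also have "\<dots> = seg a (- int (Suc k)) (2 * Suc k + 1) ! e"
        unfolding Yk using e(1) by (simp add: nth_append del: nth_seg)
      also have "\<dots> = a (0 + t)" using e by simp
      finally show "\<xi> (int q + t) = a (0 + t)" .
    qed
    then have "lambda 0 a \<le> lambda (int q) \<xi> + 2 * (1/4)^K" by (simp add: abs_le_iff)
    moreover have "2 * (1/4)^K < lambda 0 a - r" using K by (simp add: field_simps)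
    ultimately show False using J[OF \<open>J \<le> int q\<close>] by linarith
  qed
  ultimately show ?thesis using \<xi>_bi by (intro bexI[of _ \<xi>]) auto
qed

theorem proposition2p15:
  fixes \<nu> \<mu> :: real and a :: "int \<Rightarrow> nat"
  assumes "good_interval \<nu> \<mu>"
    and "a \<in> bi_seqs"
    and "ereal (lambda 0 a) = markov_value a"
    and "markov_value a \<in> ereal ` ((markov_spectrum - lagrange_spectrum) \<inter> {\<nu>..<\<mu>})"
  shows "\<exists>\<epsilon>>0. right_eps_property \<epsilon> a \<or> left_eps_property \<epsilon> a"
proof (rule ccontr)
  assume "\<not> ?thesis"
  then have no: "\<not> right_eps_property \<epsilon> a" "\<not> left_eps_property \<epsilon> a" if "\<epsilon> > 0" for \<epsilon>
    using that by blast+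
  have M: "lambda 0 a \<in> {\<nu>..<\<mu>}" "lambda 0 a \<notin> lagrange_spectrum"
    using assms(4) by (auto simp flip: assms(3))
  obtain I where I: "{\<nu>..<\<mu>} \<subseteq> (\<Union>(x, y)\<in>I. {x..<y})"
      "\<forall>(x, y)\<in>I. \<exists>B C. good_piece x y B C"
    using assms(1) unfolding good_interval_def by blast
  obtain x y where xy: "(x, y) \<in> I" "lambda 0 a \<in> {x..<y}" using I(1) M(1) by blast
  then obtain B C where piece: "good_piece x y B C" using I(2) by blast
  have "transitive_shift B" using piece unfolding good_piece_def by simp
  then obtain b where b: "b \<in> B" unfolding transitive_shift_def by auto
  \<comment> \<open>The first bound forces convergence to 0, the second keeps
    \<open>lambda 0 a + \<epsilon> k\<close> below \<open>y\<close>.\<close>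
  define \<epsilon> where "\<epsilon> k = min (1 / real (Suc k)) ((y - lambda 0 a) / 2)" for k
  have \<epsilon>: "\<epsilon> k > 0" "lambda 0 a + \<epsilon> k < y" for k
  proof -
    show "\<epsilon> k > 0" using xy(2) by (simp add: \<epsilon>_def)
    have "\<epsilon> k \<le> (y - lambda 0 a) / 2" unfolding \<epsilon>_def by (rule min.cobounded2)
    moreover have "lambda 0 a < y" using xy(2) by simp
    ultimately show "lambda 0 a + \<epsilon> k < y" by (simp add: field_simps)
  qed
  have "\<epsilon> \<longlonglongrightarrow> 0"
  proof (rule tendsto_sandwich[OF _ _ tendsto_const LIMSEQ_inverse_real_of_nat])
    show "eventually (\<lambda>k. 0 \<le> \<epsilon> k) sequentially" using \<epsilon>(1) by (simp add: less_imp_le)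
    show "eventually (\<lambda>k. \<epsilon> k \<le> inverse (real (Suc k))) sequentially"
      by (simp add: \<epsilon>_def inverse_eq_divide)
  qed
  have "decseq \<epsilon>"
    unfolding decseq_def \<epsilon>_def by (intro allI impI min.mono order_refl) (simp add: frac_le)
  define S where "S k = {c \<in> bi_seqs. markov_value c \<le> ereal (lambda 0 a + \<epsilon> k)}" for k
  have "decseq S"
    unfolding decseq_def
  proof (intro allI impI subsetI)
    fix m n c assume "m \<le> n" and c: "c \<in> S n"
    from \<open>m \<le> n\<close> have "ereal (lambda 0 a + \<epsilon> n) \<le> ereal (lambda 0 a + \<epsilon> m)"
      using \<open>decseq \<epsilon>\<close> by (simp add: decseq_def)
    with c show "c \<in> S m" unfolding S_def using order_trans by blast
  qed
  \<comment> \<open>The overlaps are words of a single element of \<open>B\<close>, so transitivity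
    applies to \<open>s k\<close> and \<open>s (Suc k)\<close> for every \<open>k\<close>.\<close>
  define s where "s k = seg b 0 k" for k
  have occ: "occurs (s k) b" for k by (simp add: s_def)
  have "x \<le> lambda 0 a" using xy(2) by simp
  have "\<exists>R Q r1 r2. R @ s (Suc k) = s k @ Q \<and> admissible (Suc k) (S k) (R @ s (Suc k)) \<and>
      R = r1 @ seg a (- int (Suc k)) (2 * Suc k + 1) @ r2" for k
  proof -
    obtain R Q r1 r2 where "R @ s (Suc k) = s k @ Q" "admissible (Suc k) (S k) (R @ s (Suc k))"
        "R = r1 @ seg a (- int (Suc k)) (2 * Suc k + 1) @ r2"
      using connecting_block[OF piece assms(2) assms(3)[symmetric] \<open>x \<le> lambda 0 a\<close> \<epsilon>(2) \<epsilon>(1)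
          no[OF \<epsilon>(1)] b occ b occ, where n = "Suc k", folded S_def] by blast
    then show ?thesis by blast
  qed
  then obtain R Q r1 r2 where blocks: "\<And>k. R k @ s (Suc k) = s k @ Q k"
      "\<And>k. admissible (Suc k) (S k) (R k @ s (Suc k))"
      "\<And>k. R k = r1 k @ seg a (- int (Suc k)) (2 * Suc k + 1) @ r2 k"
    by metis
  have "\<exists>\<xi>\<in>bi_seqs. lagrange_value \<xi> = ereal (lambda 0 a)"
    by (rule lagrange_value_of_blocks[OF blocks(1) _ blocks(2) \<open>decseq S\<close> _ _ \<open>\<epsilon> \<longlonglongrightarrow> 0\<close>
          blocks(3) assms(2)]) (simp_all add: s_def S_def)
  then show False using M(2) by (auto simp: lagrange_spectrum_def)
qed

end
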